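(* Let $n_0\in\mathbb{Z}$, $D=\{(m,n)\in\mathbb{Z}^2 : n\le n_0\}$ and $\tilde D=\{(m,n)\in\mathbb{Z}^2: n>n_0\}$. Let $F:D\to\mathbb{R}^3$ be a discrete isothermic minimal (resp. cmc) net with corresponding Gauss map $N$. Suppose that the discrete curvature line $m\mapsto F_{m,n_0}$ and the normal line congruence $m\mapsto L_{m,n_0}$ along it lie in a plane $\mathcal{P}\subset\mathbb{R}^3$, i.e. $F_{m,n_0}\in\mathcal{P}$ and $F_{m,n_0}+N_{m,n_0}\in\mathcal{P}$ for all $m\in\mathbb{Z}$. Extend $F$ to $\mathbb{Z}^2=D\cup\tilde D$ symmetrically with respect to $\mathcal{P}$, i.e. let $F_{m,n_0+k}$ be the reflection of $F_{m,n_0-k}$ across $\mathcal{P}$ for all $m\in\mathbb{Z}$ and $k\ge 1$. Then the extended net $F:\mathbb{Z}^2\to\mathbb{R}^3$ is a discrete isothermic minimal (resp. cmc) net on $\mathbb{Z}^2$.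
   Context: All notions below are used for nets on $\mathbb{Z}^2$ or on subdomains of $\mathbb{Z}^2$ (such as $D$). For a net $F$ write $F_{m,n}=F(m,n)$. An elementary quadrilateral $(ijkl)$ consists of the vertices $i=(m,n)$, $j=(m+1,n)$, $k=(m+1,n+1)$, $l=(m,n+1)$ (all in the domain). A circular net is a map $F$ from the domain to $\mathbb{R}^3$ such that $F_i,F_j,F_k,F_l$ are concircular on every elementary quadrilateral. Two circular nets $F,G$ on the same domain are parallel if corresponding edges are parallel. A (discrete) Gauss map of a circular net $F$ is a circular net $N$ parallel to $F$ with values in the unit sphere $S^2\subset\mathbb{R}^3$. The normal line at a vertex $i$ is the line $L_i$ through $F_i$ and $F_i+N_i$; the map $L$ is called the normal line congruence. The discrete curvature lines of $F$ are the discrete curves $m\mapsto F_{m,n_0}$ ($n_0$ fixed) and $n\mapsto F_{m_0,n}$ ($m_0$ fixed). For parallel circular nets $F,G$ the mixed area on $(ijkl)$ is $$A(F,G)_{ijkl}=\tfrac14\big((F_k-F_i)\wedge(G_l-G_j)+(G_k-G_i)\wedge(F_l-F_j)\big)\in\wedge^2\mathbb{R}^3,$$ and $A(F)_{ijkl}=A(F,F)_{ijkl}$. The mean curvature of $F$ with Gauss map $N$ on $(ijkl)$ is the real number $H_{ijkl}=-A(F,N)_{ijkl}/A(F)_{ijkl}$ (ratio of parallel bivectors, $A(F)_{ijkl}\neq0$). A circular net $F$ with Gauss map $N$ is called a discrete isothermic minimal net if $H_{ijkl}=0$ on every elementary quadrilateral, and a discrete isothermic cmc net if there is a constant $c\ne0$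 with $H_{ijkl}=c$ on every elementary quadrilateral. *)

theory Defs
  imports "HOL-Analysis.Analysis"
begin

text \<open>A net on a domain \<open>D \<subseteq> \<int>\<^sup>2\<close> is a total function of which only the
  values on \<open>D\<close> matter; every notion below inspects a net only at vertices of \<open>D\<close>.\<close>

type_synonym net = "int \<times> int \<Rightarrow> real ^ 3"

definition elementary_quad :: "(int \<times> int) set \<Rightarrow> int \<Rightarrow> int \<Rightarrow> bool" where
  "elementary_quad D m n \<longleftrightarrow> {(m, n), (m + 1, n), (m + 1, n + 1), (m, n + 1)} \<subseteq> D"

definition plane :: "(real ^ 3) set \<Rightarrow> bool" where
  "plane P \<longleftrightarrow> affine P \<and> aff_dim P = 2"

definition circle :: "(real ^ 3) set \<Rightarrow> bool" where
  "circle C \<longleftrightarrow> (\<exists>P c r. plane P \<and> c \<in> P \<and> r > 0 \<and> C = P \<inter> sphere c r)"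

definition concircular :: "(real ^ 3) set \<Rightarrow> bool" where
  "concircular S \<longleftrightarrow> (\<exists>C. circle C \<and> S \<subseteq> C)"

definition circular_net :: "(int \<times> int) set \<Rightarrow> net \<Rightarrow> bool" where
  "circular_net D F \<longleftrightarrow>
     (\<forall>m n. elementary_quad D m n \<longrightarrow>
        concircular {F (m, n), F (m + 1, n), F (m + 1, n + 1), F (m, n + 1)})"

text \<open>Vectors are parallel if they are linearly dependent. In particular the zero vector (a
  degenerate edge) is parallel to everything, so that for instance a constant Gauss map of a
  planar net is allowed.\<close>

definition parallel_vectors :: "real ^ 3 \<Rightarrow> real ^ 3 \<Rightarrow> bool" where
  "parallel_vectors u v \<longleftrightarrow> collinear {0, u, v}"

definition parallel_nets :: "(int \<times> int) set \<Rightarrow> net \<Rightarrow> net \<Rightarrow> bool" where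
  "parallel_nets D F G \<longleftrightarrow>
     circular_net D F \<and> circular_net D G \<and>
     (\<forall>m n. (m, n) \<in> D \<and> (m + 1, n) \<in> D \<longrightarrow>
        parallel_vectors (F (m + 1, n) - F (m, n)) (G (m + 1, n) - G (m, n))) \<and>
     (\<forall>m n. (m, n) \<in> D \<and> (m, n + 1) \<in> D \<longrightarrow>
        parallel_vectors (F (m, n + 1) - F (m, n)) (G (m, n + 1) - G (m, n)))"

definition gauss_map :: "(int \<times> int) set \<Rightarrow> net \<Rightarrow> net \<Rightarrow> bool" where
  "gauss_map D F N \<longleftrightarrow> parallel_nets D F N \<and> (\<forall>p\<in>D. N p \<in> sphere 0 1)"

text \<open>Bivectors in \<open>\<And>\<^sup>2\<real>\<^sup>3\<close> are represented by their coordinates, i.e. as skew-symmetric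
  \<open>3 \<times> 3\<close> matrices: \<open>u \<and> v = u v\<^sup>T - v u\<^sup>T\<close>.\<close>

definition wedge :: "real ^ 3 \<Rightarrow> real ^ 3 \<Rightarrow> real ^ 3 ^ 3" where
  "wedge u v = (\<chi> i j. u $ i * v $ j - u $ j * v $ i)"

definition mixed_area :: "net \<Rightarrow> net \<Rightarrow> int \<Rightarrow> int \<Rightarrow> real ^ 3 ^ 3" where
  "mixed_area F G m n =
     (let i = (m, n); j = (m + 1, n); k = (m + 1, n + 1); l = (m, n + 1)
      in (1 / 4) *\<^sub>R (wedge (F k - F i) (G l - G j) + wedge (G k - G i) (F l - F j)))"

text \<open>The mean curvature \<open>H = - A(F,N) / A(F)\<close> is a ratio of parallel bivectors, so it is
  given as a relation: \<open>H\<close> is defined on the quadrilateral and equals \<open>h\<close>.\<close>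

definition has_mean_curvature :: "net \<Rightarrow> net \<Rightarrow> int \<Rightarrow> int \<Rightarrow> real \<Rightarrow> bool" where
  "has_mean_curvature F N m n h \<longleftrightarrow>
     mixed_area F F m n \<noteq> 0 \<and> - mixed_area F N m n = h *\<^sub>R mixed_area F F m n"

lemma has_mean_curvature_unique:
  "has_mean_curvature F N m n h \<Longrightarrow> has_mean_curvature F N m n h' \<Longrightarrow> h = h'"
  unfolding has_mean_curvature_def by simp

definition isothermic_minimal_net :: "(int \<times> int) set \<Rightarrow> net \<Rightarrow> net \<Rightarrow> bool" where
  "isothermic_minimal_net D F N \<longleftrightarrow>
     circular_net D F \<and> gauss_map D F N \<and>
     (\<forall>m n. elementary_quad D m n \<longrightarrow> has_mean_curvature F N m n 0)"

definition isothermic_cmc_net :: "(int \<times> int) set \<Rightarrow> net \<Rightarrow> net \<Rightarrow> bool" where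
  "isothermic_cmc_net D F N \<longleftrightarrow>
     circular_net D F \<and> gauss_map D F N \<and>
     (\<exists>c. c \<noteq> 0 \<and> (\<forall>m n. elementary_quad D m n \<longrightarrow> has_mean_curvature F N m n c))"

text \<open>For a plane \<open>P\<close>, \<open>closest_point P\<close> is the orthogonal projection onto \<open>P\<close>.\<close>

definition reflection :: "(real ^ 3) set \<Rightarrow> real ^ 3 \<Rightarrow> real ^ 3" where
  "reflection P x = 2 *\<^sub>R closest_point P x - x"

end

theory Submission
  imports Defs
begin

text \<open>Extend the Gauss map by the linear part of the reflection in \<open>P\<close>. On the row \<open>n = n\<^sub>0\<close>
  both extensions agree with the given maps, since \<open>F\<close> lies in \<open>P\<close> and \<open>N\<close> in its direction there;
  so every edge and every quadrilateral of \<open>\<int>\<^sup>2\<close> lies in \<open>D\<close> or is the mirror image of one in \<open>D\<close>.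
  Euclidean motions preserve circles and parallelism, and act on mixed areas by conjugation.
  Mirroring reverses the vertex order of a quadrilateral, which changes the sign of
  \<open>A(F,N)\<close> and of \<open>A(F)\<close> alike, so the mean curvature is unchanged.\<close>

section \<open>Circles and parallel vectors under rigid motions\<close>

lemma plane_rigid_motion:
  fixes g :: "real ^ 3 \<Rightarrow> real ^ 3"
  assumes "orthogonal_transformation g" "plane P"
  shows "plane ((\<lambda>x. c + g x) ` P)"
proof -
  have lin: "linear g" and inj: "inj g"
    using assms(1) by (simp_all add: orthogonal_transformation_linear orthogonal_transformation_inj)
  have "affine hull (g ` P) = g ` (affine hull P)"
    using lin by (simp add: affine_hull_linear_image linear_conv_bounded_linear)
  then have "affine (g ` P)" "aff_dim (g ` P) = 2"
    using assms(2) lin inj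
    by (simp_all add: plane_def aff_dim_injective_linear_image flip: affine_hull_eq)
  moreover have "(\<lambda>x. c + g x) ` P = (+) c ` g ` P"
    by (simp add: image_image)
  ultimately show ?thesis
    unfolding plane_def by (metis affine_translation aff_dim_translation_eq)
qed

text \<open>A circle is cut out of a plane by a sphere centred in that plane. The image plane and
  the sphere of the same radius about the image of the centre again meet in a circle.\<close>

lemma concircular_rigid_motion:
  fixes g :: "real ^ 3 \<Rightarrow> real ^ 3"
  assumes g: "orthogonal_transformation g" and "concircular S"
  shows "concircular ((\<lambda>x. c + g x) ` S)"
proof -
  let ?f = "\<lambda>x. c + g x"
  obtain P z r where P: "plane P" and "z \<in> P" "r > 0" and S: "S \<subseteq> P \<inter> sphere z r"
    using assms(2) by (auto simp: concircular_def circle_def)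
  have "dist (?f x) (?f y) = dist x y" for x y
    using g by (simp add: orthogonal_transformation_isometry)
  then have "?f ` S \<subseteq> ?f ` P \<inter> sphere (?f z) r"
    using S by auto
  then show ?thesis
    unfolding concircular_def circle_def
    using plane_rigid_motion[OF g P] \<open>z \<in> P\<close> \<open>r > 0\<close> by blast
qed

lemma parallel_vectors_linear_image:
  assumes "linear g" "parallel_vectors u v"
  shows "parallel_vectors (g u) (g v)"
  using assms by (auto simp: parallel_vectors_def collinear_lemma linear_0 linear_cmul)

text \<open>Needed because mirroring reverses the direction of edges that join consecutive
  rows.\<close>

lemma parallel_vectors_minus_iff:
  "parallel_vectors (x - y) (z - w) \<longleftrightarrow> parallel_vectors (y - x) (w - z)"
proof -
  have "parallel_vectors (- u) (- v)" if "parallel_vectors u v" for u v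
    using that parallel_vectors_linear_image[of uminus] by (simp add: linear_uminus)
  from this[of "x - y" "z - w"] this[of "y - x" "w - z"] show ?thesis
    by auto
qed

section \<open>Mixed area and mean curvature under mirroring\<close>

lemma wedge_matrix_vector_mult:
  "wedge (M *v u) (M *v v) = M ** wedge u v ** transpose M"
  \<comment> \<open>In matrix form this is (M u)(M v)^T = M (u v^T) M^T, antisymmetrised in u and v;
    the proof expands it in coordinates.\<close>
  unfolding vec_eq_iff wedge_def matrix_matrix_mult_def matrix_vector_mult_def transpose_def
  by (simp add: sum_3 algebra_simps)

lemma linear_matrix_sandwich: "linear (\<lambda>X. A ** X ** B :: real ^ 'n ^ 'm)"
  by (rule linearI)
    (simp_all add: vec_eq_iff matrix_matrix_mult_def sum.distrib sum_distrib_left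
      sum_distrib_right algebra_simps)

text \<open>Swapping the rows exchanges the two diagonals up to sign, and the translations
  \<open>c\<close> and \<open>d\<close> cancel in differences. Hence each of the two wedge terms
  becomes minus the conjugate of the other, and their sum becomes minus the conjugate of the
  original sum.\<close>

lemma mixed_area_mirror:
  fixes g :: "real ^ 3 \<Rightarrow> real ^ 3"
  assumes "linear g"
    and F: "F' (m, n) = c + g (F (m, k + 1))" "F' (m + 1, n) = c + g (F (m + 1, k + 1))"
      "F' (m + 1, n + 1) = c + g (F (m + 1, k))" "F' (m, n + 1) = c + g (F (m, k))"
    and G: "G' (m, n) = d + g (G (m, k + 1))" "G' (m + 1, n) = d + g (G (m + 1, k + 1))"
      "G' (m + 1, n + 1) = d + g (G (m + 1, k))" "G' (m, n + 1) = d + g (G (m, k))"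
  shows "mixed_area F' G' m n = - (matrix g ** mixed_area F G m k ** transpose (matrix g))"
proof -
  let ?i = "(m, k)" and ?j = "(m + 1, k)" and ?k = "(m + 1, k + 1)" and ?l = "(m, k + 1)"
  note sandwich = linear_matrix_sandwich[of "matrix g" "transpose (matrix g)"]
  have g: "wedge (g x - g y) (g z - g w) =
      - (matrix g ** wedge (w - z) (y - x) ** transpose (matrix g))" for x y z w
  proof -
    have "wedge (g x - g y) (g z - g w) = - wedge (g w - g z) (g y - g x)"
      by (simp add: wedge_def vec_eq_iff algebra_simps)
    also have "\<dots> = - wedge (matrix g *v (w - z)) (matrix g *v (y - x))"
      using assms(1) by (simp add: linear_diff)
    finally show ?thesis
      by (simp only: wedge_matrix_vector_mult)
  qed
  have "mixed_area F' G' m n =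
      (1 / 4) *\<^sub>R (- (matrix g ** wedge (G ?k - G ?i) (F ?l - F ?j) ** transpose (matrix g))
        - matrix g ** wedge (F ?k - F ?i) (G ?l - G ?j) ** transpose (matrix g))"
    unfolding mixed_area_def Let_def F G by (simp add: g)
  then show ?thesis
    unfolding mixed_area_def Let_def
    by (simp add: linear_add[OF sandwich] linear_cmul[OF sandwich] scaleR_diff_right scaleR_add_right)
qed

lemma has_mean_curvature_mirror:
  fixes g :: "real ^ 3 \<Rightarrow> real ^ 3"
  assumes g: "orthogonal_transformation g" and h: "has_mean_curvature F N m k h"
    and F: "F' (m, n) = c + g (F (m, k + 1))" "F' (m + 1, n) = c + g (F (m + 1, k + 1))"
      "F' (m + 1, n + 1) = c + g (F (m + 1, k))" "F' (m, n + 1) = c + g (F (m, k))"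
    and N: "N' (m, n) = d + g (N (m, k + 1))" "N' (m + 1, n) = d + g (N (m + 1, k + 1))"
      "N' (m + 1, n + 1) = d + g (N (m + 1, k))" "N' (m, n + 1) = d + g (N (m, k))"
  shows "has_mean_curvature F' N' m n h"
proof -
  have lin: "linear g"
    using g by (rule orthogonal_transformation_linear)
  let ?M = "matrix g"
  have M: "transpose ?M ** ?M = mat 1"
    using g by (simp add: orthogonal_transformation_matrix orthogonal_matrix)
  \<comment> \<open>Conjugation by an orthogonal matrix is undone by conjugation with its transpose,
    so the mixed area of the mirrored net with itself cannot vanish.\<close>
  have "X = 0" if "?M ** X ** transpose ?M = 0" for X
  proof -
    have "transpose ?M ** (?M ** X ** transpose ?M) ** ?M = 0"
      unfolding that by simp
    also have "transpose ?M ** (?M ** X ** transpose ?M) ** ?M =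
        (transpose ?M ** ?M) ** X ** (transpose ?M ** ?M)"
      by (simp only: matrix_mul_assoc)
    finally show ?thesis
      by (simp add: M)
  qed
  moreover have "mixed_area F F m k \<noteq> 0" "mixed_area F N m k = - h *\<^sub>R mixed_area F F m k"
    using h by (simp_all add: has_mean_curvature_def neg_eq_iff_add_eq_0 eq_neg_iff_add_eq_0 add.commute)
  ultimately show ?thesis
    unfolding has_mean_curvature_def
      mixed_area_mirror[where F' = F' and G' = F', OF lin F F] mixed_area_mirror[OF lin F N]
    by (auto simp: linear_cmul[OF linear_matrix_sandwich] linear_neg[OF linear_matrix_sandwich])
qed

section \<open>Nets on the two half-planes: change of values off the domain, mirroring and
  gluing\<close>

lemma circular_net_cong:
  assumes "\<And>p. p \<in> D \<Longrightarrow> F p = F' p" "circular_net D F"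
  shows "circular_net D F'"
  using assms unfolding circular_net_def elementary_quad_def by simp

lemma gauss_map_cong:
  assumes "\<And>p. p \<in> D \<Longrightarrow> F p = F' p" "\<And>p. p \<in> D \<Longrightarrow> N p = N' p" "gauss_map D F N"
  shows "gauss_map D F' N'"
  using assms circular_net_cong[of D F F'] circular_net_cong[of D N N']
  unfolding gauss_map_def parallel_nets_def by simp

lemma has_mean_curvature_cong:
  assumes "\<And>p. p \<in> D \<Longrightarrow> F p = F' p" "\<And>p. p \<in> D \<Longrightarrow> N p = N' p" "elementary_quad D m n"
    "has_mean_curvature F N m n h"
  shows "has_mean_curvature F' N' m n h"
  using assms unfolding has_mean_curvature_def mixed_area_def elementary_quad_def by simp

lemma circular_net_mirror:
  assumes g: "orthogonal_transformation g" and F: "circular_net {(m, n). n \<le> n\<^sub>0} F"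
    and F': "\<And>m n. n \<ge> n\<^sub>0 \<Longrightarrow> F' (m, n) = c + g (F (m, 2 * n\<^sub>0 - n))"
  shows "circular_net {(m, n). n \<ge> n\<^sub>0} F'"
  unfolding circular_net_def
proof (intro allI impI)
  fix m n
  assume "elementary_quad {(m, n). n \<ge> n\<^sub>0} m n"
  then have n: "n \<ge> n\<^sub>0"
    by (simp add: elementary_quad_def)
  \<comment> \<open>The rows \<open>n\<close> and \<open>n + 1\<close> mirror to
    \<open>k + 1\<close> and \<open>k\<close>, so \<open>k\<close> is the lower row of the mirrored
    quadrilateral; its upper row \<open>k + 1\<close> is at most \<open>n\<^sub>0\<close>.\<close>
  define k where "k = 2 * n\<^sub>0 - n - 1"
  have k: "2 * n\<^sub>0 - n = k + 1" "2 * n\<^sub>0 - (n + 1) = k"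
    by (simp_all add: k_def)
  have "elementary_quad {(m, n). n \<le> n\<^sub>0} m k"
    using n by (simp add: elementary_quad_def k_def)
  then have "concircular {F (m, k), F (m + 1, k), F (m + 1, k + 1), F (m, k + 1)}"
    using F by (simp add: circular_net_def)
  from concircular_rigid_motion[OF g this, of c]
  show "concircular {F' (m, n), F' (m + 1, n), F' (m + 1, n + 1), F' (m, n + 1)}"
    using n by (simp add: F' k insert_commute)
qed

text \<open>The Gauss map is transformed without the translation \<open>c\<close>: edge directions
  see only \<open>g\<close>, and \<open>g\<close> alone keeps the unit sphere in place.\<close>

lemma gauss_map_mirror:
  assumes g: "orthogonal_transformation g" and FN: "gauss_map {(m, n). n \<le> n\<^sub>0} F N"
    and F': "\<And>m n. n \<ge> n\<^sub>0 \<Longrightarrow> F' (m, n) = c + g (F (m, 2 * n\<^sub>0 - n))"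
    and N': "\<And>m n. n \<ge> n\<^sub>0 \<Longrightarrow> N' (m, n) = g (N (m, 2 * n\<^sub>0 - n))"
  shows "gauss_map {(m, n). n \<ge> n\<^sub>0} F' N'"
  unfolding gauss_map_def parallel_nets_def
proof (intro conjI allI impI ballI)
  have lin: "linear g"
    using g by (rule orthogonal_transformation_linear)
  show "circular_net {(m, n). n \<ge> n\<^sub>0} F'"
    using circular_net_mirror[OF g, of n\<^sub>0 F F' c] F' FN
    by (simp add: gauss_map_def parallel_nets_def)
  show "circular_net {(m, n). n \<ge> n\<^sub>0} N'"
    using circular_net_mirror[OF g, of n\<^sub>0 N N' 0] N' FN
    by (simp add: gauss_map_def parallel_nets_def)
  show "N' p \<in> sphere 0 1" if "p \<in> {(m, n). n \<ge> n\<^sub>0}" for p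
    using that FN g by (auto simp: N' gauss_map_def orthogonal_transformation_norm)
  fix m n
  define k where "k = 2 * n\<^sub>0 - n - 1"
  have k: "2 * n\<^sub>0 - n = k + 1" "2 * n\<^sub>0 - (n + 1) = k"
    by (simp_all add: k_def)
  show "parallel_vectors (F' (m + 1, n) - F' (m, n)) (N' (m + 1, n) - N' (m, n))"
    if "(m, n) \<in> {(m, n). n \<ge> n\<^sub>0} \<and> (m + 1, n) \<in> {(m, n). n \<ge> n\<^sub>0}"
  proof -
    have "parallel_vectors (F (m + 1, k + 1) - F (m, k + 1)) (N (m + 1, k + 1) - N (m, k + 1))"
      using FN that by (simp add: gauss_map_def parallel_nets_def k_def)
    from parallel_vectors_linear_image[OF lin this] show ?thesis
      using that by (simp add: F' N' k linear_diff[OF lin])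
  qed
  show "parallel_vectors (F' (m, n + 1) - F' (m, n)) (N' (m, n + 1) - N' (m, n))"
    if "(m, n) \<in> {(m, n). n \<ge> n\<^sub>0} \<and> (m, n + 1) \<in> {(m, n). n \<ge> n\<^sub>0}"
  proof -
    have "k + 1 \<le> n\<^sub>0"
      using that by (simp add: k_def)
    then have "parallel_vectors (F (m, k + 1) - F (m, k)) (N (m, k + 1) - N (m, k))"
      using FN by (simp add: gauss_map_def parallel_nets_def)
    then have "parallel_vectors (F (m, k) - F (m, k + 1)) (N (m, k) - N (m, k + 1))"
      by (subst parallel_vectors_minus_iff)
    from parallel_vectors_linear_image[OF lin this] show ?thesis
      using that by (simp add: F' N' k linear_diff[OF lin])
  qed
qed

text \<open>Both half-planes contain the row \<open>n\<^sub>0\<close>, so no quadrilateral straddles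
  them: for integers, either \<open>n + 1\<close> is at most \<open>n\<^sub>0\<close> or
  \<open>n\<close> is at least \<open>n\<^sub>0\<close>.\<close>

lemma elementary_quad_half_planes:
  fixes n\<^sub>0 :: int
  shows "elementary_quad {(m, n). n \<le> n\<^sub>0} m n \<or> elementary_quad {(m, n). n \<ge> n\<^sub>0} m n"
  by (auto simp: elementary_quad_def)

lemma gauss_map_glue:
  fixes n\<^sub>0 :: int
  assumes "gauss_map {(m, n). n \<le> n\<^sub>0} F N" "gauss_map {(m, n). n \<ge> n\<^sub>0} F N"
  shows "gauss_map UNIV F N"
proof -
  have *: "circular_net UNIV G"
    if "circular_net {(m, n). n \<le> n\<^sub>0} G" "circular_net {(m, n). n \<ge> n\<^sub>0} G" for G
    using that elementary_quad_half_planes[of n\<^sub>0] unfolding circular_net_def by blast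
  have cases: "n \<le> n\<^sub>0 \<or> n \<ge> n\<^sub>0" "n + 1 \<le> n\<^sub>0 \<or> n \<ge> n\<^sub>0" for n
    by auto
  show ?thesis
    unfolding gauss_map_def parallel_nets_def
  proof (intro conjI allI impI ballI)
    show "circular_net UNIV F" "circular_net UNIV N"
      using assms by (auto simp: gauss_map_def parallel_nets_def intro!: *)
    show "N p \<in> sphere 0 1" for p
      using assms cases(1)[of "snd p"] by (cases p) (auto simp: gauss_map_def)
    show "parallel_vectors (F (m + 1, n) - F (m, n)) (N (m + 1, n) - N (m, n))" for m n
      using assms cases(1)[of n] by (auto simp: gauss_map_def parallel_nets_def)
    show "parallel_vectors (F (m, n + 1) - F (m, n)) (N (m, n + 1) - N (m, n))" for m n
      using assms cases(2)[of n] by (auto simp: gauss_map_def parallel_nets_def)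
  qed
qed

section \<open>Reflections in coordinates and the extension across the plane\<close>

lemma plane_unit_normal:
  assumes "plane P"
  obtains a b where "norm a = 1" "P = {x. a \<bullet> x = b}"
proof -
  have hull: "affine hull P = P"
    using assms by (simp add: plane_def affine_hull_eq)
  have "aff_dim P = DIM(real ^ 3) - 1"
    using assms by (simp add: plane_def)
  then have "\<exists>a b. a \<noteq> 0 \<and> P = {x. a \<bullet> x = b}"
    unfolding aff_dim_eq_hyperplane hull by simp
  then obtain a b where a: "a \<noteq> 0" and P: "P = {x. a \<bullet> x = b}"
    by (elim exE conjE)
  show ?thesis
  proof (rule that)
    show "norm (a /\<^sub>R norm a) = 1"
      using a by simp
    show "P = {x. (a /\<^sub>R norm a) \<bullet> x = b /\<^sub>R norm a}"
      using a by (simp add: P)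
  qed
qed

text \<open>For a unit vector \<open>a\<close> this is the Householder map, the common linear part
  of the reflections in all planes with normal \<open>a\<close>.\<close>

definition linear_reflection :: "real ^ 3 \<Rightarrow> real ^ 3 \<Rightarrow> real ^ 3" where
  "linear_reflection a x = x - (2 * (a \<bullet> x)) *\<^sub>R a"

lemma orthogonal_transformation_linear_reflection:
  assumes "norm a = 1"
  shows "orthogonal_transformation (linear_reflection a)"
proof -
  have "a \<bullet> a = 1"
    using assms by (simp add: dot_square_norm)
  then show ?thesis
    unfolding orthogonal_transformation_def linear_reflection_def
    by (auto intro!: linearI simp: algebra_simps inner_commute)
qed

lemma reflection_hyperplane:
  assumes "norm a = 1"
  shows "reflection {x. a \<bullet> x = b} x = (2 * b) *\<^sub>R a + linear_reflection a x"
proof -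
  have a: "a \<bullet> a = 1"
    using assms by (simp add: dot_square_norm)
  \<comment> \<open>The foot of the perpendicular from \<open>x\<close>. Its distance to
    \<open>x\<close> is the absolute value of \<open>a \<bullet> x - b\<close>, which by
    Cauchy-Schwarz bounds the distance from \<open>x\<close> to any point of the plane from
    below.\<close>
  define p where "p = x - (a \<bullet> x - b) *\<^sub>R a"
  have p: "p = closest_point {x. a \<bullet> x = b} x"
  proof (rule closest_point_unique)
    show "p \<in> {x. a \<bullet> x = b}"
      by (simp add: p_def a algebra_simps)
    have "norm (x - p) = \<bar>a \<bullet> x - b\<bar>"
      using assms by (simp add: p_def)
    moreover have "\<bar>a \<bullet> x - b\<bar> \<le> norm (x - z)" if "a \<bullet> z = b" for z
      using Cauchy_Schwarz_ineq2[of a "x - z"] that assms by (simp add: inner_diff_right)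
    ultimately show "\<forall>z\<in>{x. a \<bullet> x = b}. dist x p \<le> dist x z"
      by (simp add: dist_norm)
  qed (simp_all add: convex_hyperplane closed_hyperplane)
  show ?thesis
    unfolding reflection_def linear_reflection_def p[symmetric] p_def
    by (simp add: vec_eq_iff algebra_simps)
qed

text \<open>The extended Gauss map is chosen before the curvature value \<open>h\<close>, so one
  construction serves the minimal case with \<open>h = 0\<close> and the cmc case with
  \<open>h\<close> the given constant.\<close>

lemma mirror_extension:
  fixes n\<^sub>0 :: int and D :: "(int \<times> int) set"
  assumes D: "D = {(m, n). n \<le> n\<^sub>0}"
    and P: "plane P"
    and curvature_line: "\<And>m. F (m, n\<^sub>0) \<in> P"
    and normal_lines: "\<And>m. F (m, n\<^sub>0) + N (m, n\<^sub>0) \<in> P"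
    and ext_D: "\<And>p. p \<in> D \<Longrightarrow> F_ext p = F p"
    and ext_refl: "\<And>m k. k \<ge> 1 \<Longrightarrow> F_ext (m, n\<^sub>0 + k) = reflection P (F (m, n\<^sub>0 - k))"
    and gauss: "gauss_map D F N"
  shows "\<exists>N_ext. (\<forall>p\<in>D. N_ext p = N p) \<and> gauss_map UNIV F_ext N_ext \<and>
    (\<forall>h. (\<forall>m n. elementary_quad D m n \<longrightarrow> has_mean_curvature F N m n h) \<longrightarrow>
      (\<forall>m n. has_mean_curvature F_ext N_ext m n h))"
proof -
  obtain a b where a: "norm a = 1" and Pab: "P = {x. a \<bullet> x = b}"
    using plane_unit_normal[OF P] .
  define g where "g = linear_reflection a"
  define c where "c = (2 * b) *\<^sub>R a"
  define N_ext :: net where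
    "N_ext = (\<lambda>(m, n). if n \<le> n\<^sub>0 then N (m, n) else g (N (m, 2 * n\<^sub>0 - n)))"
  have g: "orthogonal_transformation g"
    unfolding g_def using a by (rule orthogonal_transformation_linear_reflection)
  \<comment> \<open>Points of the plane satisfy \<open>a \<bullet> x = b\<close>, so
    \<open>g\<close> subtracts exactly the vector \<open>c\<close> that is then added back.\<close>
  have F_fixed: "c + g (F (m, n\<^sub>0)) = F (m, n\<^sub>0)" for m
    using curvature_line[of m] by (simp add: Pab c_def g_def linear_reflection_def)
  \<comment> \<open>\<open>N\<close> is the difference of two points of the plane, hence orthogonal
    to its normal. This makes the two formulas for \<open>N_ext\<close> agree on the row
    \<open>n\<^sub>0\<close>.\<close>
  have "a \<bullet> N (m, n\<^sub>0) = 0" for m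
    using curvature_line[of m] normal_lines[of m] by (simp add: Pab inner_add_right)
  then have N_fixed: "g (N (m, n\<^sub>0)) = N (m, n\<^sub>0)" for m
    by (simp add: g_def linear_reflection_def)
  have N_lower: "N_ext (m, n) = N (m, n)" if "n \<le> n\<^sub>0" for m n
    using that by (simp add: N_ext_def)
  have N_upper: "N_ext (m, n) = g (N (m, 2 * n\<^sub>0 - n))" if "n \<ge> n\<^sub>0" for m n
    using that by (cases "n = n\<^sub>0") (simp_all add: N_ext_def N_fixed)
  \<comment> \<open>The reflection hypothesis starts one row above \<open>n\<^sub>0\<close>;
    \<open>F_fixed\<close> extends the formula to the row \<open>n\<^sub>0\<close> itself, which
    quadrilaterals just above it use.\<close>
  have F_upper: "F_ext (m, n) = c + g (F (m, 2 * n\<^sub>0 - n))" if "n \<ge> n\<^sub>0" for m n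
  proof (cases "n = n\<^sub>0")
    case False
    then show ?thesis
      using that ext_refl[of "n - n\<^sub>0" m]
      by (simp add: Pab reflection_hyperplane[OF a] c_def g_def algebra_simps)
  qed (simp add: D ext_D F_fixed)
  have lower: "F p = F_ext p" "N p = N_ext p" if "p \<in> D" for p
    using that by (auto simp: D ext_D N_lower)
  have "gauss_map UNIV F_ext N_ext"
    using gauss_map_cong[OF lower gauss, unfolded D]
      gauss_map_mirror[OF g gauss[unfolded D] F_upper N_upper]
    by (rule gauss_map_glue)
  moreover have "has_mean_curvature F_ext N_ext m n h"
    if h: "\<forall>m n. elementary_quad D m n \<longrightarrow> has_mean_curvature F N m n h" for m n h
  \<comment> \<open>A quadrilateral not contained in \<open>D\<close> has \<open>n\<close> at least
    \<open>n\<^sub>0\<close>, so it is the mirror image of the one in \<open>D\<close> with lower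
    row \<open>k\<close>.\<close>
  proof (cases "n + 1 \<le> n\<^sub>0")
    case True
    then have "elementary_quad D m n"
      by (simp add: D elementary_quad_def)
    with h have "has_mean_curvature F N m n h"
      by simp
    with lower \<open>elementary_quad D m n\<close> show ?thesis
      by (rule has_mean_curvature_cong)
  next
    case False
    define k where "k = 2 * n\<^sub>0 - n - 1"
    have k: "2 * n\<^sub>0 - n = k + 1" "2 * n\<^sub>0 - (n + 1) = k"
      by (simp_all add: k_def)
    have "elementary_quad D m k"
      using False by (simp add: D elementary_quad_def k_def)
    then have "has_mean_curvature F N m k h"
      using h by blast
    from has_mean_curvature_mirror[OF g this, where c = c and d = 0] show ?thesis
      using False by (simp add: F_upper N_upper k)
  qed
  ultimately show ?thesis
    using lower(2) by (intro exI[of _ N_ext] conjI ballI allI impI) simp_all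
qed

theorem proposition2p8:
  fixes n\<^sub>0 :: int and D :: "(int \<times> int) set" and F N F_ext :: net
    and P :: "(real ^ 3) set"
  assumes D: "D = {(m, n). n \<le> n\<^sub>0}"
    and P: "plane P"
    and curvature_line: "\<And>m. F (m, n\<^sub>0) \<in> P"
    and normal_lines: "\<And>m. F (m, n\<^sub>0) + N (m, n\<^sub>0) \<in> P"
    and ext_D: "\<And>p. p \<in> D \<Longrightarrow> F_ext p = F p"
    and ext_refl: "\<And>m k. k \<ge> 1 \<Longrightarrow> F_ext (m, n\<^sub>0 + k) = reflection P (F (m, n\<^sub>0 - k))"
  shows "(isothermic_minimal_net D F N \<longrightarrow>
            (\<exists>N_ext. (\<forall>p\<in>D. N_ext p = N p) \<and> isothermic_minimal_net UNIV F_ext N_ext)) \<and>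
         (isothermic_cmc_net D F N \<longrightarrow>
            (\<exists>N_ext. (\<forall>p\<in>D. N_ext p = N p) \<and> isothermic_cmc_net UNIV F_ext N_ext))"
proof -
  have gauss_circular: "circular_net UNIV F'" if "gauss_map UNIV F' N'" for F' N'
    using that by (simp add: gauss_map_def parallel_nets_def)
  show ?thesis
  proof (intro conjI impI)
    assume F: "isothermic_minimal_net D F N"
    then have "gauss_map D F N"
      by (simp add: isothermic_minimal_net_def)
    from mirror_extension[OF assms this] obtain N_ext
      where N_ext: "\<forall>p\<in>D. N_ext p = N p" "gauss_map UNIV F_ext N_ext"
        "\<forall>m n. has_mean_curvature F_ext N_ext m n 0"
      using F unfolding isothermic_minimal_net_def by blast
    then show "\<exists>N_ext. (\<forall>p\<in>D. N_ext p = N p) \<and> isothermic_minimal_net UNIV F_ext N_ext"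
      using gauss_circular[OF N_ext(2)] unfolding isothermic_minimal_net_def by blast
  next
    assume F: "isothermic_cmc_net D F N"
    then obtain c where c: "c \<noteq> 0" and gauss: "gauss_map D F N"
      and h: "\<forall>m n. elementary_quad D m n \<longrightarrow> has_mean_curvature F N m n c"
      by (auto simp: isothermic_cmc_net_def)
    from mirror_extension[OF assms gauss] obtain N_ext
      where N_ext: "\<forall>p\<in>D. N_ext p = N p" "gauss_map UNIV F_ext N_ext"
        "\<forall>m n. has_mean_curvature F_ext N_ext m n c"
      using h by blast
    then show "\<exists>N_ext. (\<forall>p\<in>D. N_ext p = N p) \<and> isothermic_cmc_net UNIV F_ext N_ext"
      using gauss_circular[OF N_ext(2)] c unfolding isothermic_cmc_net_def by blast
  qed
qed

end
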